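(* Let $R$ be a finite commutative reduced ring with non-zero identity, let $M_1,\dots,M_n$ be its (pairwise distinct) minimal prime ideals, so that $n$ is the number of minimal prime ideals of $R$. Let $\Gamma(R)$ be the zero divisor graph of $R$. If $n=1$, then $\mathrm{box}(\Gamma(R))=\dim_{TH}(\Gamma(R))=0$. If $n=2$, then \[\mathrm{box}(\Gamma(R))=\dim_{TH}(\Gamma(R))=\begin{cases}0 & \text{if both minimal prime ideals are lonely,}\\ 1 & \text{if exactly one minimal prime ideal is lonely,}\\ 2 & \text{if neither is lonely.}\end{cases}\] If $n\ge 3$, then \[\mathrm{box}(\Gamma(R))=\dim_{TH}(\Gamma(R))=\begin{cases}n-1 & \text{if there exists } i\in\{1,\dots,n\} \text{ such that } M_i \text{ is lonely,}\\ n & \text{otherwise.}\end{cases}\]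
   Context: All graphs are finite and simple. The boxicity $\mathrm{box}(G)$ of a graph $G$ is the minimum integer $d\ge 0$ such that there exist $d$ interval graphs $I_1,\dots,I_d$ on the vertex set $V(G)$ with $E(G)=\bigcap_{j=1}^d E(I_j)$ (equivalently, $G$ is the intersection graph of a family of axis-parallel boxes in $\mathbb{R}^d$). For a finite set $V$, $\alpha\colon V\to\mathbb{R}$ and $S\in\mathbb{R}$, the threshold graph $T(\alpha,S)$ has vertex set $V$ and edges all $\{v,w\}$, $v\neq w$, with $\alpha(v)+\alpha(w)\ge S$; a graph is a threshold graph if it is of this form. The threshold dimension $\dim_{TH}(G)$ is the minimum $d\ge 0$ such that there exist $d$ threshold graphs $H_1,\dots,H_d$ on $V(G)$ with $E(G)=\bigcap_{j=1}^d E(H_j)$. In both definitions the empty intersection ($d=0$) is the set of all pairs of vertices, so the parameter is $0$ exactly for complete graphs (including the graph with no vertices). A ring is reduced if $0$ is its only nilpotent element. $Z(R)$ is the set of $r\in R$ for which there is $s\in R\setminus\{0\}$ with $rs=0$. The zero divisor graph $\Gamma(R)$ has vertex set $Z(R)\setminus\{0\}$; two distinct vertices $r,s$ are adjacent iff $rs=0$. The minimal prime ideal $M_j$ is called lonely if the set $\left(\bigcap_{i\in\{1,\dots,n\}, i\ne j} M_i\right)\setminus M_j$ has exactly one element. *)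

theory Defs
  imports Complex_Main "HOL-Algebra.Ideal" "Graph_Theory.Pair_Digraph"
begin

section \<open>Interval graphs, threshold graphs and the associated dimensions\<close>

text \<open>
  A finite simple graph is a \<^term>\<open>G :: 'a pair_pre_digraph\<close> with \<^prop>\<open>pair_graph G\<close>: its edge
  relation \<^term>\<open>parcs G\<close> is a symmetric irreflexive relation on the finite set \<^term>\<open>pverts G\<close>.
\<close>

definition interval_graph :: "'a pair_pre_digraph \<Rightarrow> bool" where
  "interval_graph G \<longleftrightarrow> pair_graph G \<and>
     (\<exists>l r :: 'a \<Rightarrow> real.
        (\<forall>v\<in>pverts G. l v \<le> r v) \<and>
        (\<forall>u\<in>pverts G. \<forall>v\<in>pverts G. u \<noteq> v \<longrightarrow>
           ((u, v) \<in> parcs G \<longleftrightarrow> {l u..r u} \<inter> {l v..r v} \<noteq> {})))"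

definition threshold_graph_of :: "'a set \<Rightarrow> ('a \<Rightarrow> real) \<Rightarrow> real \<Rightarrow> 'a pair_pre_digraph" where
  "threshold_graph_of V \<alpha> S =
     \<lparr>pverts = V, parcs = {(v, w). v \<in> V \<and> w \<in> V \<and> v \<noteq> w \<and> \<alpha> v + \<alpha> w \<ge> S}\<rparr>"

definition threshold_graph :: "'a pair_pre_digraph \<Rightarrow> bool" where
  "threshold_graph G \<longleftrightarrow> finite (pverts G) \<and> (\<exists>\<alpha> S. G = threshold_graph_of (pverts G) \<alpha> S)"

text \<open>
  Intersecting with all pairs of distinct vertices only matters for \<^prop>\<open>d = 0\<close>, where it makes
  the empty intersection the edge set of the complete graph.
\<close>

definition is_intersection_of ::
    "'a pair_pre_digraph \<Rightarrow> nat \<Rightarrow> ('a pair_pre_digraph \<Rightarrow> bool) \<Rightarrow> bool" where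
  "is_intersection_of G d \<C> \<longleftrightarrow>
     (\<exists>H :: nat \<Rightarrow> 'a pair_pre_digraph.
        (\<forall>j\<in>{1..d}. \<C> (H j) \<and> pverts (H j) = pverts G) \<and>
        parcs G = {(u, v). u \<in> pverts G \<and> v \<in> pverts G \<and> u \<noteq> v} \<inter> (\<Inter>j\<in>{1..d}. parcs (H j)))"

text \<open>
  Every finite simple graph is such an intersection for some \<^term>\<open>d\<close> (take one threshold graph,
  which is also an interval graph, for each pair of distinct non-adjacent vertices), so both minima
  exist.
\<close>

definition boxicity :: "'a pair_pre_digraph \<Rightarrow> nat" where
  "boxicity G = (LEAST d. is_intersection_of G d interval_graph)"

definition threshold_dimension :: "'a pair_pre_digraph \<Rightarrow> nat" where
  "threshold_dimension G = (LEAST d. is_intersection_of G d threshold_graph)"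

section \<open>Rings\<close>

definition reduced_ring :: "('a, 'b) ring_scheme \<Rightarrow> bool" where
  "reduced_ring R \<longleftrightarrow>
     (\<forall>x\<in>carrier R. (\<exists>k::nat. k > 0 \<and> x [^]\<^bsub>R\<^esub> k = \<zero>\<^bsub>R\<^esub>) \<longrightarrow> x = \<zero>\<^bsub>R\<^esub>)"

definition minimal_primeideal :: "'a set \<Rightarrow> ('a, 'b) ring_scheme \<Rightarrow> bool" where
  "minimal_primeideal P R \<longleftrightarrow>
     primeideal P R \<and> (\<forall>Q. primeideal Q R \<and> Q \<subseteq> P \<longrightarrow> Q = P)"

definition zero_divisors :: "('a, 'b) ring_scheme \<Rightarrow> 'a set" where
  "zero_divisors R =
     {r \<in> carrier R. \<exists>s\<in>carrier R - {\<zero>\<^bsub>R\<^esub>}. r \<otimes>\<^bsub>R\<^esub> s = \<zero>\<^bsub>R\<^esub>}"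

definition zero_divisor_graph :: "('a, 'b) ring_scheme \<Rightarrow> 'a pair_pre_digraph" where
  "zero_divisor_graph R =
     \<lparr>pverts = zero_divisors R - {\<zero>\<^bsub>R\<^esub>},
      parcs = {(r, s). r \<in> zero_divisors R - {\<zero>\<^bsub>R\<^esub>} \<and> s \<in> zero_divisors R - {\<zero>\<^bsub>R\<^esub>} \<and>
                 r \<noteq> s \<and> r \<otimes>\<^bsub>R\<^esub> s = \<zero>\<^bsub>R\<^esub>}\<rparr>"

lemma pair_graph_zero_divisor_graph:
  fixes R :: "('a, 'b) ring_scheme"
  assumes "cring R" "finite (carrier R)"
  shows "pair_graph (zero_divisor_graph R)"
proof -
  interpret cring R by fact
  let ?G = "zero_divisor_graph R"
  have V: "finite (pverts ?G)"
    using assms(2) by (auto simp: zero_divisor_graph_def zero_divisors_def)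
  have "parcs ?G \<subseteq> pverts ?G \<times> pverts ?G"
    by (auto simp: zero_divisor_graph_def)
  then have "finite (parcs ?G)"
    using V by (meson finite_SigmaI finite_subset)
  moreover have "sym (parcs ?G)"
    by (auto simp: zero_divisor_graph_def zero_divisors_def sym_def m_comm)
  ultimately show ?thesis
    using V by unfold_locales (auto simp: zero_divisor_graph_def symmetric_def)
qed

text \<open>
  The sets \<^term>\<open>M i\<close> with \<^prop>\<open>i \<in> {1..n}\<close> are the minimal prime ideals of \<^term>\<open>R\<close>.  Intersecting with
  \<^term>\<open>carrier R\<close> only matters for \<^prop>\<open>n = 1\<close>, where the intersection of the empty family of
  ideals is \<^term>\<open>carrier R\<close>.
\<close>

definition lonely :: "('a, 'b) ring_scheme \<Rightarrow> nat \<Rightarrow> (nat \<Rightarrow> 'a set) \<Rightarrow> nat \<Rightarrow> bool" where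
  "lonely R n M j \<longleftrightarrow> card (carrier R \<inter> (\<Inter>i\<in>{1..n} - {j}. M i) - M j) = 1"

end

theory Submission
  imports Defs
begin

text \<open>
  Encode a ring element by its support, the set of minimal primes not containing it.  In a reduced
  ring a product vanishes iff the supports are disjoint, and by prime avoidance every set of minimal
  primes is a support; a minimal prime is lonely iff only one element has its singleton as support.

  Separating the pairs that meet in a given prime takes one threshold graph per prime, and a lonely
  prime can be served by the graphs of the other primes.  Conversely, two elements with support
  \<open>{j}\<close>, for every non-lonely \<open>j\<close>, induce a cocktail party graph, of which an interval graph
  separates at most one pair.  For \<open>n \<ge> 3\<close>, consider the pairs formed by an element of support
  \<open>{u}\<close> and one of support \<open>{u, v}\<close> as arcs \<open>(u, v)\<close>.  The arcs separated by one interval graph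
  form a star or at most five of the six arcs of a triangle.  If \<open>t\<close> of at most \<open>n - 2\<close>
  interval graphs are of the triangle type, then \<open>w \<ge> t + 2\<close> primes are not the centre of a star,
  and \<open>w (w - 1) \<le> 5 t\<close> is impossible.
\<close>

section \<open>Interval graphs and threshold graphs\<close>

text \<open>Two closed intervals meet iff neither ends before the other starts. In this form the
  forbidden-subgraph arguments reduce to linear arithmetic on endpoints.\<close>

lemma interval_graphE:
  assumes "interval_graph H"
  obtains l r :: "'a \<Rightarrow> real"
  where "\<And>v. v \<in> pverts H \<Longrightarrow> l v \<le> r v"
    and "\<And>u v. (u, v) \<in> parcs H \<Longrightarrow> l u \<le> r v \<and> l v \<le> r u"
    and "\<And>u v. \<lbrakk>u \<in> pverts H; v \<in> pverts H; u \<noteq> v; (u, v) \<notin> parcs H\<rbrakk> \<Longrightarrow> r u < l v \<or> r v < l u"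
proof -
  from assms obtain l r :: "'a \<Rightarrow> real" where lr: "\<forall>v\<in>pverts H. l v \<le> r v"
    and adj: "\<forall>u\<in>pverts H. \<forall>v\<in>pverts H. u \<noteq> v \<longrightarrow>
           ((u, v) \<in> parcs H \<longleftrightarrow> {l u..r u} \<inter> {l v..r v} \<noteq> {})"
    and H: "pair_graph H"
    unfolding interval_graph_def by blast
  interpret pair_graph H by (fact H)
  show thesis
  proof
    show "l v \<le> r v" if "v \<in> pverts H" for v using lr that by blast
    show "l u \<le> r v \<and> l v \<le> r u" if "(u, v) \<in> parcs H" for u v
    proof (cases "u = v")
      case True
      then show ?thesis using lr in_arcsD1[OF that] by auto
    next
      case False
      have "{l u..r u} \<inter> {l v..r v} \<noteq> {}"
        using adj False that in_arcsD1[OF that] in_arcsD2[OF that] by blast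
      then show ?thesis by auto
    qed
    show "r u < l v \<or> r v < l u"
      if "u \<in> pverts H" "v \<in> pverts H" "u \<noteq> v" "(u, v) \<notin> parcs H" for u v
    proof (rule ccontr)
      assume "\<not> (r u < l v \<or> r v < l u)"
      then have "max (l u) (l v) \<in> {l u..r u} \<inter> {l v..r v}"
        using lr that by auto
      then show False using adj that by blast
    qed
  qed
qed

text \<open>The intervals of \<open>a\<close> and \<open>b\<close> are disjoint, so there is a gap
  between them. Those of \<open>c\<close> and \<open>d\<close> both meet both sides, hence both
  contain the gap and intersect.\<close>

lemma interval_graph_no_induced_C4:
  assumes "interval_graph H"
    and "{a, b, c, d} \<subseteq> pverts H"
    and "a \<noteq> b" "(a, b) \<notin> parcs H" "c \<noteq> d" "(c, d) \<notin> parcs H"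
    and "(a, c) \<in> parcs H" "(a, d) \<in> parcs H" "(b, c) \<in> parcs H" "(b, d) \<in> parcs H"
  shows False
proof -
  obtain l r :: "'a \<Rightarrow> real"
    where lr: "\<And>v. v \<in> pverts H \<Longrightarrow> l v \<le> r v"
    and adj: "\<And>u v. (u, v) \<in> parcs H \<Longrightarrow> l u \<le> r v \<and> l v \<le> r u"
    and nadj: "\<And>u v. \<lbrakk>u \<in> pverts H; v \<in> pverts H; u \<noteq> v; (u, v) \<notin> parcs H\<rbrakk> \<Longrightarrow> r u < l v \<or> r v < l u"
    using interval_graphE[OF assms(1)] by metis
  have "r a < l b \<or> r b < l a" "r c < l d \<or> r d < l c"
    using nadj assms by auto
  moreover note adj[OF assms(7)] adj[OF assms(8)] adj[OF assms(9)] adj[OF assms(10)]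
  ultimately show False by linarith
qed

text \<open>
  The three intervals of \<^term>\<open>a\<close>, \<^term>\<open>b\<close>, \<^term>\<open>c\<close> share a point, and two of \<^term>\<open>x\<close>,
  \<^term>\<open>y\<close>, \<^term>\<open>z\<close> lie on the same side of it.
\<close>

lemma interval_graph_no_net:
  assumes "interval_graph H"
    and "{a, b, c, x, y, z} \<subseteq> pverts H"
    and "(a, b) \<in> parcs H" "(b, c) \<in> parcs H" "(a, c) \<in> parcs H"
    and "(a, x) \<in> parcs H" "(b, y) \<in> parcs H" "(c, z) \<in> parcs H"
    and "a \<noteq> y" "a \<noteq> z" "b \<noteq> x" "b \<noteq> z" "c \<noteq> x" "c \<noteq> y"
    and "(a, y) \<notin> parcs H" "(a, z) \<notin> parcs H" "(b, x) \<notin> parcs H"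
        "(b, z) \<notin> parcs H" "(c, x) \<notin> parcs H" "(c, y) \<notin> parcs H"
  shows False
proof -
  obtain l r :: "'a \<Rightarrow> real"
    where lr: "\<And>v. v \<in> pverts H \<Longrightarrow> l v \<le> r v"
    and adj: "\<And>u v. (u, v) \<in> parcs H \<Longrightarrow> l u \<le> r v \<and> l v \<le> r u"
    and nadj: "\<And>u v. \<lbrakk>u \<in> pverts H; v \<in> pverts H; u \<noteq> v; (u, v) \<notin> parcs H\<rbrakk> \<Longrightarrow> r u < l v \<or> r v < l u"
    using interval_graphE[OF assms(1)] by metis
  have "r a < l y \<or> r y < l a" "r a < l z \<or> r z < l a" "r b < l x \<or> r x < l b"
    "r b < l z \<or> r z < l b" "r c < l x \<or> r x < l c" "r c < l y \<or> r y < l c"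
    using nadj assms by auto
  moreover have "l x \<le> r x" "l y \<le> r y" "l z \<le> r z"
    using lr assms(2) by auto
  moreover note adj[OF assms(3)] adj[OF assms(4)] adj[OF assms(5)]
    adj[OF assms(6)] adj[OF assms(7)] adj[OF assms(8)]
  ultimately show False by linarith
qed

section \<open>Threshold graphs and their interval representations\<close>

lemma threshold_graph_threshold_graph_of:
  "finite V \<Longrightarrow> threshold_graph (threshold_graph_of V \<alpha> S)"
  unfolding threshold_graph_def by (auto simp: threshold_graph_of_def)

text \<open>
  The vertices of weight at least \<^term>\<open>S / 2\<close> become intervals starting at \<^term>\<open>0::real\<close>, the others
  become points.  Positions are ranks, so that distinct vertices of equal small weight get
  distinct points.
\<close>

lemma threshold_graph_imp_interval_graph:
  assumes "threshold_graph H"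
  shows "interval_graph H"
proof -
  define V where "V = pverts H"
  from assms obtain \<alpha> S where fin: "finite V" and H: "H = threshold_graph_of V \<alpha> S"
    unfolding threshold_graph_def V_def by blast
  obtain f :: "'a \<Rightarrow> nat" where f: "inj_on f V"
    using finite_imp_inj_to_nat_seg[OF fin] by metis
  \<comment> \<open>Shifting by half the threshold turns adjacency into a sign condition on the sum
    of two weights.\<close>
  define \<beta> where "\<beta> v = \<alpha> v - S / 2" for v
  have arc: "(u, v) \<in> parcs H \<longleftrightarrow> u \<in> V \<and> v \<in> V \<and> u \<noteq> v \<and> \<beta> u + \<beta> v \<ge> 0" for u v
    unfolding H threshold_graph_of_def \<beta>_def by (auto simp: field_simps)
  \<comment> \<open>The cardinality of \<open>below v\<close> is the rank of \<open>v\<close> by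
    decreasing weight, ties broken by \<open>f\<close>; that of \<open>reach v\<close> is the last
    rank whose weight is large enough to be joined to \<open>v\<close>.\<close>
  define below where "below v = {w \<in> V. \<beta> w > \<beta> v \<or> \<beta> w = \<beta> v \<and> f w \<le> f v}" for v
  define reach where "reach v = {w \<in> V. \<beta> w \<ge> - \<beta> v}" for v
  have fb: "finite (below v)" "finite (reach v)" for v
    using fin unfolding below_def reach_def by auto
  have below_inj: "card (below u) \<noteq> card (below v)" if "u \<in> V" "v \<in> V" "u \<noteq> v" for u v
  proof -
    have "f u \<noteq> f v" using f that by (auto dest: inj_onD)
    moreover have "below u \<subset> below v" if "u \<in> V" "v \<in> V" "\<beta> u > \<beta> v \<or> \<beta> u = \<beta> v \<and> f u < f v" for u v
      using that unfolding below_def by (force simp: psubset_eq)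
    ultimately have "below u \<subset> below v \<or> below v \<subset> below u"
      using \<open>u \<in> V\<close> \<open>v \<in> V\<close> by (meson linorder_less_linear)
    then show ?thesis
      using psubset_card_mono fb by (metis less_irrefl)
  qed
  \<comment> \<open>Both sets are initial segments of the same ordering, so comparing cardinalities
    amounts to comparing the sets; \<open>v\<close> itself witnesses strictness.\<close>
  have reach_iff: "card (below v) \<le> card (reach u) \<longleftrightarrow> \<beta> u + \<beta> v \<ge> 0" if "v \<in> V" for u v
  proof
    assume "\<beta> u + \<beta> v \<ge> 0"
    then have "below v \<subseteq> reach u" unfolding below_def reach_def by auto
    then show "card (below v) \<le> card (reach u)" by (simp add: card_mono fb)
  next
    assume le: "card (below v) \<le> card (reach u)"
    show "\<beta> u + \<beta> v \<ge> 0"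
    proof (rule ccontr)
      assume "\<not> ?thesis"
      then have "reach u \<subset> below v"
        using that unfolding below_def reach_def by (auto simp: psubset_eq)
      then show False using le psubset_card_mono[OF fb(1)] by (meson leD)
    qed
  qed
  define l where "l v = (if \<beta> v \<ge> 0 then 0 else real (card (below v)))" for v
  define r where "r v = (if \<beta> v \<ge> 0 then real (card (reach v)) else real (card (below v)))" for v
  have "pair_graph H"
  proof -
    have "parcs H \<subseteq> V \<times> V" using arc by auto
    then have "finite (parcs H)" using fin by (meson finite_SigmaI finite_subset)
    moreover have "sym (parcs H)" by (auto simp: sym_def arc)
    ultimately show ?thesis
      using fin by unfold_locales (auto simp: arc V_def symmetric_def)
  qed
  moreover have "\<forall>v\<in>V. l v \<le> r v" unfolding l_def r_def by auto
  moreover have "(u, v) \<in> parcs H \<longleftrightarrow> {l u..r u} \<inter> {l v..r v} \<noteq> {}"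
    if uv: "u \<in> V" "v \<in> V" "u \<noteq> v" for u v
  proof -
    have *: "{l u..r u} \<inter> {l v..r v} \<noteq> {} \<longleftrightarrow> l u \<le> r v \<and> l v \<le> r u"
      using \<open>\<forall>v\<in>V. l v \<le> r v\<close> uv by auto
    show ?thesis
      unfolding * arc using uv below_inj[OF uv] reach_iff[of v u] reach_iff[of u v]
      unfolding l_def r_def by (auto simp: add.commute)
  qed
  ultimately show ?thesis
    unfolding interval_graph_def V_def by blast
qed

section \<open>Intersections of graphs\<close>

text \<open>Renumbering along a bijection lets the graphs be indexed by primes instead of
  \<open>{1..d}\<close>.\<close>

lemma is_intersection_of_index:
  assumes "finite J"
    and "\<And>j. j \<in> J \<Longrightarrow> \<C> (H j) \<and> pverts (H j) = pverts G"
    and "parcs G = {(u, v). u \<in> pverts G \<and> v \<in> pverts G \<and> u \<noteq> v} \<inter> (\<Inter>j\<in>J. parcs (H j))"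
  shows "is_intersection_of G (card J) \<C>"
proof -
  obtain h where h: "bij_betw h {1..card J} J"
    using ex_bij_betw_nat_finite_1[OF assms(1)] by blast
  then have im: "h ` {1..card J} = J" by (simp add: bij_betw_def)
  have "(\<Inter>j\<in>{1..card J}. parcs (H (h j))) = (\<Inter>j\<in>h ` {1..card J}. parcs (H j))"
    by simp
  also have "\<dots> = (\<Inter>j\<in>J. parcs (H j))" by (simp only: im)
  finally have "parcs G = {(u, v). u \<in> pverts G \<and> v \<in> pverts G \<and> u \<noteq> v} \<inter>
      (\<Inter>j\<in>{1..card J}. parcs (H (h j)))"
    using assms(3) by simp
  moreover have "\<forall>j\<in>{1..card J}. \<C> (H (h j)) \<and> pverts (H (h j)) = pverts G"
    using assms(2) im by blast
  ultimately show ?thesis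
    unfolding is_intersection_of_def by (intro exI[of _ "\<lambda>j. H (h j)"] conjI)
qed

text \<open>Since threshold graphs are interval graphs, boxicity never exceeds threshold dimension;
  an upper bound for the latter that matches a lower bound for the former fixes both.\<close>

lemma boxicity_eq_threshold_dimension_eq:
  assumes th: "is_intersection_of G k threshold_graph"
    and low: "\<And>d. is_intersection_of G d interval_graph \<Longrightarrow> k \<le> d"
  shows "boxicity G = k" "threshold_dimension G = k"
proof -
  have mono: "is_intersection_of G d interval_graph" if "is_intersection_of G d threshold_graph" for d
    using that threshold_graph_imp_interval_graph unfolding is_intersection_of_def by blast
  show "boxicity G = k" "threshold_dimension G = k"
    unfolding boxicity_def threshold_dimension_def
    using th low mono by (blast intro: Least_equality)+
qed

lemma is_intersection_ofE:
  assumes "is_intersection_of G d \<C>"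
  obtains H where "\<And>j. j \<in> {1..d} \<Longrightarrow> \<C> (H j)" "\<And>j. j \<in> {1..d} \<Longrightarrow> pverts (H j) = pverts G"
    "\<And>j. j \<in> {1..d} \<Longrightarrow> parcs G \<subseteq> parcs (H j)"
    "\<And>u v. \<lbrakk>u \<in> pverts G; v \<in> pverts G; u \<noteq> v; (u, v) \<notin> parcs G\<rbrakk> \<Longrightarrow> \<exists>j\<in>{1..d}. (u, v) \<notin> parcs (H j)"
proof -
  from assms obtain H where H: "\<forall>j\<in>{1..d}. \<C> (H j) \<and> pverts (H j) = pverts G"
    "parcs G = {(u, v). u \<in> pverts G \<and> v \<in> pverts G \<and> u \<noteq> v} \<inter> (\<Inter>j\<in>{1..d}. parcs (H j))"
    unfolding is_intersection_of_def by blast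
  show thesis
    by (rule that[of H]) (use H in blast)+
qed

text \<open>Each pair \<open>a i\<close>, \<open>b i\<close> is separated by some interval graph,
  and two pairs separated by the same graph would induce a 4-cycle in it. Hence the choice of graph
  is injective.\<close>

lemma card_le_of_cocktail_party:
  fixes a b :: "'i \<Rightarrow> 'a"
  assumes G: "is_intersection_of G d interval_graph"
    and V: "\<And>i. i \<in> N \<Longrightarrow> a i \<in> pverts G \<and> b i \<in> pverts G \<and> a i \<noteq> b i \<and> (a i, b i) \<notin> parcs G"
    and adj: "\<And>i j. \<lbrakk>i \<in> N; j \<in> N; i \<noteq> j\<rbrakk> \<Longrightarrow>
      (a i, a j) \<in> parcs G \<and> (a i, b j) \<in> parcs G \<and> (b i, a j) \<in> parcs G \<and> (b i, b j) \<in> parcs G"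
  shows "card N \<le> d"
proof -
  obtain H where H: "\<And>j. j \<in> {1..d} \<Longrightarrow> interval_graph (H j)"
    "\<And>j. j \<in> {1..d} \<Longrightarrow> pverts (H j) = pverts G"
    "\<And>j. j \<in> {1..d} \<Longrightarrow> parcs G \<subseteq> parcs (H j)"
    "\<And>u v. \<lbrakk>u \<in> pverts G; v \<in> pverts G; u \<noteq> v; (u, v) \<notin> parcs G\<rbrakk> \<Longrightarrow> \<exists>j\<in>{1..d}. (u, v) \<notin> parcs (H j)"
    using is_intersection_ofE[OF G] by metis
  have "\<forall>i\<in>N. \<exists>k\<in>{1..d}. (a i, b i) \<notin> parcs (H k)"
    using H(4) V by blast
  then obtain k where k: "\<And>i. i \<in> N \<Longrightarrow> k i \<in> {1..d} \<and> (a i, b i) \<notin> parcs (H (k i))"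
    by metis
  have "inj_on k N"
  proof (rule inj_onI, rule ccontr)
    fix i j assume ij: "i \<in> N" "j \<in> N" "k i = k j" "i \<noteq> j"
    note ki = k[OF ij(1)] and kj = k[OF ij(2)]
    have "(a i, a j) \<in> parcs (H (k i))" "(a i, b j) \<in> parcs (H (k i))"
      "(b i, a j) \<in> parcs (H (k i))" "(b i, b j) \<in> parcs (H (k i))"
      using adj[OF ij(1,2,4)] H(3)[of "k i"] ki by auto
    moreover have "{a i, b i, a j, b j} \<subseteq> pverts (H (k i))"
      using V[OF ij(1)] V[OF ij(2)] H(2)[of "k i"] ki by simp
    moreover have "(a j, b j) \<notin> parcs (H (k i))" using kj ij(3) by simp
    ultimately show False
      using interval_graph_no_induced_C4[of "H (k i)" "a i" "b i" "a j" "b j"]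
        H(1)[of "k i"] ki V[OF ij(1)] V[OF ij(2)] by blast
  qed
  then have "card N \<le> card {1..d}"
    using k by (intro card_inj_on_le[of k]) auto
  then show ?thesis by simp
qed

section \<open>Covering arcs by stars and triangles\<close>

text \<open>Given an arc between \<open>a\<close> and \<open>b\<close>, one that avoids
  \<open>a\<close> must contain \<open>b\<close> and some third vertex \<open>c\<close>; one that
  avoids \<open>b\<close> must meet both of these, so it joins \<open>a\<close> and
  \<open>c\<close>. An arc meeting all three sides has both ends in the triangle.\<close>

lemma star_or_triangle:
  fixes C :: "('i \<times> 'i) set"
  assumes loopfree: "\<And>u v. (u, v) \<in> C \<Longrightarrow> u \<noteq> v"
    and meet: "\<And>u v u' v'. \<lbrakk>(u, v) \<in> C; (u', v') \<in> C\<rbrakk> \<Longrightarrow> {u, v} \<inter> {u', v'} \<noteq> {}"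
    and nostar: "\<And>a. \<exists>u v. (u, v) \<in> C \<and> a \<noteq> u \<and> a \<noteq> v"
  obtains a b c where "a \<noteq> b" "b \<noteq> c" "a \<noteq> c"
    "C \<subseteq> {(a, b), (b, a), (b, c), (c, b), (a, c), (c, a)}"
proof -
  obtain a b where ab: "(a, b) \<in> C" using nostar by blast
  obtain u v where uv: "(u, v) \<in> C" "a \<noteq> u" "a \<noteq> v" using nostar[of a] by blast
  define c where "c = (if u = b then v else u)"
  have c: "(b, c) \<in> C \<or> (c, b) \<in> C" "c \<noteq> a" "c \<noteq> b"
    using meet[OF ab uv(1)] uv loopfree[OF uv(1)] by (auto simp: c_def)
  obtain u' v' where uv': "(u', v') \<in> C" "b \<noteq> u'" "b \<noteq> v'" using nostar[of b] by blast
  have ac: "(a, c) \<in> C \<or> (c, a) \<in> C"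
    using meet[OF ab uv'(1)] c(1) meet[OF _ uv'(1), of b c] meet[OF _ uv'(1), of c b] uv' c by auto
  show thesis
  proof (rule that[of a b c])
    show "C \<subseteq> {(a, b), (b, a), (b, c), (c, b), (a, c), (c, a)}"
    proof (rule subrelI)
      fix x y assume xy: "(x, y) \<in> C"
      have "{a, b} \<inter> {x, y} \<noteq> {}" "{b, c} \<inter> {x, y} \<noteq> {}" "{a, c} \<inter> {x, y} \<noteq> {}"
        using meet[OF ab xy] meet[OF _ xy] c(1) ac by (metis insert_commute)+
      then show "(x, y) \<in> {(a, b), (b, a), (b, c), (c, b), (a, c), (c, a)}"
        using loopfree[OF xy] c loopfree[OF ab] by auto
    qed
  qed (use loopfree[OF ab] c in auto)
qed

text \<open>Deleting the centre of each star leaves \<open>w\<close> vertices whose arcs the other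
  sets must cover. Five arcs per triangle instead of six decide the count: with six it would read
  \<open>(w - 3) * (w - 4) \<le> 0\<close>, which \<open>w = 3\<close> and \<open>w = 4\<close>
  satisfy.\<close>

lemma arcs_cover_bound:
  fixes C :: "nat \<Rightarrow> ('i \<times> 'i) set"
  assumes N: "finite N" "card N \<ge> 2"
    and cover: "\<And>u v. \<lbrakk>u \<in> N; v \<in> N; u \<noteq> v\<rbrakk> \<Longrightarrow> \<exists>k\<in>{1..d}. (u, v) \<in> C k"
    and star: "\<And>k. k \<in> {1..d} \<Longrightarrow>
      (\<exists>a. \<forall>(u, v)\<in>C k. a = u \<or> a = v) \<or> finite (C k) \<and> card (C k) \<le> 5"
  shows "card N - 1 \<le> d"
proof (rule ccontr)
  assume "\<not> ?thesis"
  then have d: "d + 2 \<le> card N" using N(2) by simp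
  define S where "S = {k \<in> {1..d}. \<exists>a. \<forall>(u, v)\<in>C k. a = u \<or> a = v}"
  define T where "T = {1..d} - S"
  obtain z where z: "\<And>k u v. \<lbrakk>k \<in> S; (u, v) \<in> C k\<rbrakk> \<Longrightarrow> z k = u \<or> z k = v"
  proof -
    have "\<forall>k\<in>S. \<exists>a. \<forall>(u, v)\<in>C k. a = u \<or> a = v" unfolding S_def by blast
    then obtain z where "\<forall>k\<in>S. \<forall>(u, v)\<in>C k. z k = u \<or> z k = v" by metis
    then show thesis using that by fast
  qed
  have fS: "finite S" "finite T" "S \<subseteq> {1..d}" unfolding S_def T_def by auto
  have cST: "card S + card T = d"
    using card_Diff_subset[of S "{1..d}"] card_mono[of "{1..d}" S] fS unfolding T_def by auto
  define W where "W = N - z ` S"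
  have fW: "finite W" using N unfolding W_def by auto
  have cW: "card T + 2 \<le> card W"
  proof -
    have "card N - card (z ` S) \<le> card W"
      unfolding W_def using diff_card_le_card_Diff fS by blast
    moreover have "card (z ` S) \<le> card S" using card_image_le fS by blast
    ultimately show ?thesis using cST d by linarith
  qed
  \<comment> \<open>A star covers only arcs through its centre, and no centre lies in
    \<open>W\<close>.\<close>
  have "W \<times> W - Id \<subseteq> (\<Union>k\<in>T. C k)"
  proof (rule subrelI)
    fix u v assume "(u, v) \<in> W \<times> W - Id"
    then have uv: "u \<in> W" "v \<in> W" "u \<noteq> v" by auto
    then obtain k where k: "k \<in> {1..d}" "(u, v) \<in> C k" using cover unfolding W_def by blast
    have "k \<notin> S" using z[of k u v] k uv unfolding W_def by auto
    then show "(u, v) \<in> (\<Union>k\<in>T. C k)" using k unfolding T_def by auto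
  qed
  moreover have T5: "finite (C k) \<and> card (C k) \<le> 5" if "k \<in> T" for k
    using star[of k] that unfolding T_def S_def by blast
  moreover have "finite (\<Union>k\<in>T. C k)" using fS T5 by auto
  ultimately have "card (W \<times> W - Id) \<le> card (\<Union>k\<in>T. C k)"
    by (intro card_mono)
  also have "\<dots> \<le> (\<Sum>k\<in>T. card (C k))" using card_UN_le fS by blast
  also have "\<dots> \<le> card T * 5" using sum_bounded_above[of T "\<lambda>k. card (C k)" 5] T5 by simp
  finally have "card (W \<times> W - Id) \<le> card T * 5" .
  moreover have "card (W \<times> W - Id) = card W * card W - card W"
  proof -
    have "W \<times> W - Id = W \<times> W - Id_on W" by auto
    moreover have "Id_on W = (\<lambda>x. (x, x)) ` W" by auto
    moreover have "card ((\<lambda>x. (x, x)) ` W) = card W" by (simp add: card_image inj_on_def)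
    ultimately show ?thesis
      using fW by (simp add: card_Diff_subset card_cartesian_product image_subset_iff)
  qed
  ultimately have "card W * card W \<le> 5 * card T + card W" by simp
  also have "\<dots> + 10 \<le> 6 * card W" using cW by simp
  \<comment> \<open>The inequality says \<open>(w - 3)^2 + 1 \<le> 0\<close>; integers avoid
    truncated subtraction.\<close>
  finally have "int (card W) * int (card W) + 10 \<le> 6 * int (card W)"
    by (metis (mono_tags, lifting) add_le_cancel_right of_nat_add of_nat_le_iff of_nat_mult of_nat_numeral)
  moreover have "(int (card W) - 3)\<^sup>2 \<ge> 0" by simp
  ultimately show False by (simp add: power2_eq_square algebra_simps)
qed


section \<open>Graphs of disjoint supports\<close>

text \<open>All that is used of the ring. The empty set is missing because it is the support of
  zero, and \<open>N\<close> because it is the support of the elements that are not zero divisors.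
  Several vertices may share a support.\<close>

locale disjointness_graph =
  fixes G :: "'a pair_pre_digraph" and s :: "'a \<Rightarrow> 'i set" and N :: "'i set"
  assumes finite_N: "finite N"
    and finite_verts: "finite (pverts G)"
    and supports: "s ` pverts G = {A. A \<subseteq> N \<and> A \<noteq> {} \<and> A \<noteq> N}"
    and arc_iff: "(u, v) \<in> parcs G \<longleftrightarrow>
      u \<in> pverts G \<and> v \<in> pverts G \<and> u \<noteq> v \<and> s u \<inter> s v = {}"
begin

lemma support_props:
  assumes "v \<in> pverts G"
  shows "s v \<subseteq> N" "s v \<noteq> {}" "s v \<noteq> N"
proof -
  have "s v \<in> {A. A \<subseteq> N \<and> A \<noteq> {} \<and> A \<noteq> N}" using assms supports by blast
  then show "s v \<subseteq> N" "s v \<noteq> {}" "s v \<noteq> N" by auto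
qed

lemma is_intersection_threshold:
  "is_intersection_of G (card N) threshold_graph"
proof (rule is_intersection_of_index[OF finite_N])
  \<comment> \<open>The sum falls below -1 only if \<open>j\<close> lies in both supports.\<close>
  let ?H = "\<lambda>j. threshold_graph_of (pverts G) (\<lambda>v. if j \<in> s v then -1 else 0) (-1)"
  show "threshold_graph (?H j) \<and> pverts (?H j) = pverts G" if "j \<in> N" for j
    using threshold_graph_threshold_graph_of[OF finite_verts]
    by (simp add: threshold_graph_of_def)
  have "(u, v) \<in> parcs G \<longleftrightarrow> (u, v) \<in> {(u, v). u \<in> pverts G \<and> v \<in> pverts G \<and> u \<noteq> v} \<inter>
      (\<Inter>j\<in>N. parcs (?H j))" for u v
    using support_props(1)[of u] by (auto simp: arc_iff threshold_graph_of_def split: if_splits)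
  then show "parcs G = {(u, v). u \<in> pverts G \<and> v \<in> pverts G \<and> u \<noteq> v} \<inter> (\<Inter>j\<in>N. parcs (?H j))"
    by auto
qed

text \<open>
  Give a vertex weight 2 for \<^term>\<open>j\<close> and weight 1 for \<^term>\<open>i\<close> in its support, and separate pairs of
  total weight above 3.  Two distinct vertices containing \<^term>\<open>i\<close> are then separated by any
  \<^prop>\<open>j \<noteq> i\<close> in one of their supports, and such a \<^term>\<open>j\<close> exists when only one vertex has support
  \<^term>\<open>{i}\<close>.
\<close>

lemma is_intersection_threshold_unique:
  assumes i: "i \<in> N"
    and unique: "\<And>u v. \<lbrakk>u \<in> pverts G; v \<in> pverts G; s u = {i}; s v = {i}\<rbrakk> \<Longrightarrow> u = v"
  shows "is_intersection_of G (card N - 1) threshold_graph"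
proof -
  \<comment> \<open>The weights are negated because a threshold graph keeps the pairs with large
    sums. Disjoint supports count \<open>i\<close> and \<open>j\<close> at most once each, so the
    sum stays at least -3.\<close>
  let ?\<alpha> = "\<lambda>j v. (if j \<in> s v then -2 else 0) + (if i \<in> s v then -1 else (0::real))"
  let ?H = "\<lambda>j. threshold_graph_of (pverts G) (?\<alpha> j) (-3)"
  have "is_intersection_of G (card (N - {i})) threshold_graph"
  proof (rule is_intersection_of_index)
    show "finite (N - {i})" using finite_N by simp
    show "threshold_graph (?H j) \<and> pverts (?H j) = pverts G" for j
      using threshold_graph_threshold_graph_of[OF finite_verts]
      by (simp add: threshold_graph_of_def)
    have "s u \<inter> s v = {} \<longleftrightarrow> (\<forall>j\<in>N - {i}. ?\<alpha> j u + ?\<alpha> j v \<ge> -3)"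
      if uv: "u \<in> pverts G" "v \<in> pverts G" "u \<noteq> v" for u v
    proof
      assume "s u \<inter> s v = {}"
      then show "\<forall>j\<in>N - {i}. ?\<alpha> j u + ?\<alpha> j v \<ge> -3" by auto
    next
      assume *: "\<forall>j\<in>N - {i}. ?\<alpha> j u + ?\<alpha> j v \<ge> -3"
      show "s u \<inter> s v = {}"
      proof (rule ccontr)
        assume "s u \<inter> s v \<noteq> {}"
        then obtain k where k: "k \<in> s u" "k \<in> s v" by auto
        show False
        proof (cases "k = i")
          case False
          then show False using * k support_props(1)[OF uv(1)] by (auto split: if_splits)
        next
          case True
          have "s u \<noteq> {i} \<or> s v \<noteq> {i}" using unique uv by blast
          then obtain j where "j \<noteq> i" "j \<in> s u \<union> s v" using k True by auto
          moreover then have "j \<in> N - {i}"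
            using support_props(1)[OF uv(1)] support_props(1)[OF uv(2)] by auto
          ultimately show False using * k True by (auto split: if_splits)
        qed
      qed
    qed
    then have "(u, v) \<in> parcs G \<longleftrightarrow> (u, v) \<in> {(u, v). u \<in> pverts G \<and> v \<in> pverts G \<and> u \<noteq> v} \<inter>
        (\<Inter>j\<in>N - {i}. parcs (?H j))" for u v
      by (auto simp only: arc_iff threshold_graph_of_def pair_pre_digraph.simps mem_Collect_eq
          case_prod_conv Int_iff INT_iff)
    then show "parcs G = {(u, v). u \<in> pverts G \<and> v \<in> pverts G \<and> u \<noteq> v} \<inter>
        (\<Inter>j\<in>N - {i}. parcs (?H j))"
      by auto
  qed
  then show ?thesis using i finite_N by simp
qed

text \<open>Two vertices for each singleton support form a cocktail party: equal supports meet,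
  distinct singletons do not.\<close>

lemma card_nonunique_le:
  assumes G: "is_intersection_of G d interval_graph"
    and J: "\<And>j. j \<in> J \<Longrightarrow> \<exists>u\<in>pverts G. \<exists>v\<in>pverts G. u \<noteq> v \<and> s u = {j} \<and> s v = {j}"
  shows "card J \<le> d"
proof -
  obtain a b where ab: "\<And>j. j \<in> J \<Longrightarrow>
      a j \<in> pverts G \<and> b j \<in> pverts G \<and> a j \<noteq> b j \<and> s (a j) = {j} \<and> s (b j) = {j}"
    using J by metis
  show ?thesis
  proof (rule card_le_of_cocktail_party[OF G, of _ a b])
    show "a i \<in> pverts G \<and> b i \<in> pverts G \<and> a i \<noteq> b i \<and> (a i, b i) \<notin> parcs G" if "i \<in> J" for i
      using ab[OF that] by (simp add: arc_iff)
    show "(a i, a j) \<in> parcs G \<and> (a i, b j) \<in> parcs G \<and> (b i, a j) \<in> parcs G \<and> (b i, b j) \<in> parcs G"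
      if "i \<in> J" "j \<in> J" "i \<noteq> j" for i j
      using ab[OF that(1)] ab[OF that(2)] that(3) by (auto simp: arc_iff)
  qed
qed

text \<open>
  An interval graph containing \<^term>\<open>G\<close> separates \<^term>\<open>{u}\<close> from \<^term>\<open>{u, v}\<close> only for arcs
  \<^term>\<open>(u, v)\<close> that pairwise meet (no induced 4-cycle), and never for all six arcs of a triangle (no
  net).
\<close>

lemma card_minus_1_le:
  assumes G: "is_intersection_of G d interval_graph"
    and N3: "card N \<ge> 3"
  shows "card N - 1 \<le> d"
proof -
  obtain H where H: "\<And>j. j \<in> {1..d} \<Longrightarrow> interval_graph (H j)"
    "\<And>j. j \<in> {1..d} \<Longrightarrow> pverts (H j) = pverts G"
    "\<And>j. j \<in> {1..d} \<Longrightarrow> parcs G \<subseteq> parcs (H j)"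
    "\<And>u v. \<lbrakk>u \<in> pverts G; v \<in> pverts G; u \<noteq> v; (u, v) \<notin> parcs G\<rbrakk> \<Longrightarrow> \<exists>j\<in>{1..d}. (u, v) \<notin> parcs (H j)"
    using is_intersection_ofE[OF G] by metis
  \<comment> \<open>With at least three indices, a set of at most two is proper and therefore a
    support.\<close>
  have "\<exists>x\<in>pverts G. s x = A" if A: "A \<subseteq> N" "A \<noteq> {}" "card A \<le> 2" for A
  proof -
    have "A \<in> s ` pverts G" using A N3 by (auto simp: supports)
    then show ?thesis by auto
  qed
  then obtain g where gA: "\<And>A. \<lbrakk>A \<subseteq> N; A \<noteq> {}; card A \<le> 2\<rbrakk> \<Longrightarrow> g A \<in> pverts G \<and> s (g A) = A"
    by metis
  have g: "g {u, v} \<in> pverts G" "s (g {u, v}) = {u, v}" if "u \<in> N" "v \<in> N" for u v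
    using gA[of "{u, v}"] that by (auto simp: card_insert_if)
  have g1: "g {u} \<in> pverts G" "s (g {u}) = {u}" if "u \<in> N" for u
    using g[of u u] that by auto
  define C where "C k = {(u, v) \<in> N \<times> N. u \<noteq> v \<and> (g {u}, g {u, v}) \<notin> parcs (H k)}" for k
  show ?thesis
  proof (rule arcs_cover_bound[OF finite_N, of d C])
    show "2 \<le> card N" using N3 by simp
  next
    fix u v assume uv: "u \<in> N" "v \<in> N" "u \<noteq> v"
    have "g {u} \<noteq> g {u, v}" using g[OF uv(1,2)] g1[OF uv(1)] uv(3) by auto
    then have "\<exists>k\<in>{1..d}. (g {u}, g {u, v}) \<notin> parcs (H k)"
      using H(4)[of "g {u}" "g {u, v}"] g[OF uv(1,2)] g1[OF uv(1)] by (auto simp: arc_iff)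
    then show "\<exists>k\<in>{1..d}. (u, v) \<in> C k" using uv unfolding C_def by auto
  next
    fix k assume k: "k \<in> {1..d}"
    note Hk = H(1-3)[OF k]
    have edge: "(x, y) \<in> parcs (H k)"
      if "x \<in> pverts G" "y \<in> pverts G" "s x \<inter> s y = {}" for x y
    proof -
      have "x \<noteq> y" using support_props(2)[of x] that by auto
      then show ?thesis using Hk(3) that arc_iff by blast
    qed
    \<comment> \<open>For disjoint arcs, the supports from one arc are disjoint from those of the
      other, so two separated pairs would induce a 4-cycle.\<close>
    have meet: "{u, v} \<inter> {u', v'} \<noteq> {}" if uv: "(u, v) \<in> C k" "(u', v') \<in> C k" for u v u' v'
    proof
      assume disj: "{u, v} \<inter> {u', v'} = {}"
      have N: "u \<in> N" "v \<in> N" "u' \<in> N" "v' \<in> N" "u \<noteq> v" "u' \<noteq> v'"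
        and ne: "(g {u}, g {u, v}) \<notin> parcs (H k)" "(g {u'}, g {u', v'}) \<notin> parcs (H k)"
        using uv unfolding C_def by auto
      have dist: "g {u} \<noteq> g {u, v}" "g {u'} \<noteq> g {u', v'}"
        using g[OF N(1,2)] g1[OF N(1)] g[OF N(3,4)] g1[OF N(3)] N(5,6) by auto
      have sub: "{g {u}, g {u, v}, g {u'}, g {u', v'}} \<subseteq> pverts (H k)"
        using g[OF N(1,2)] g1[OF N(1)] g[OF N(3,4)] g1[OF N(3)] Hk(2) by auto
      show False
        by (rule interval_graph_no_induced_C4[OF Hk(1) sub dist(1) ne(1) dist(2) ne(2)];
            rule edge; use g[OF N(1,2)] g1[OF N(1)] g[OF N(3,4)] g1[OF N(3)] disj in auto)
    qed
    show "(\<exists>a. \<forall>(u, v)\<in>C k. a = u \<or> a = v) \<or> finite (C k) \<and> card (C k) \<le> 5"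
    proof (cases "\<exists>a. \<forall>u v. (u, v) \<in> C k \<longrightarrow> a = u \<or> a = v")
      case False
      then have nostar: "\<exists>u v. (u, v) \<in> C k \<and> a \<noteq> u \<and> a \<noteq> v" for a by blast
      have loopfree: "u \<noteq> v" if "(u, v) \<in> C k" for u v using that unfolding C_def by auto
      obtain a b c where abc: "a \<noteq> b" "b \<noteq> c" "a \<noteq> c"
        and sub: "C k \<subseteq> {(a, b), (b, a), (b, c), (c, b), (a, c), (c, a)}"
        using star_or_triangle[of "C k", OF loopfree meet nostar] by metis
      let ?T = "{(a, b), (b, a), (b, c), (c, b), (a, c), (c, a)}"
      \<comment> \<open>Otherwise the three singletons form a triangle, each with a pendant vertex
        supported on the complementary pair: a net.\<close>
      have "C k \<noteq> ?T"
      proof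
        assume eq: "C k = ?T"
        then have "(a, b) \<in> C k" "(b, c) \<in> C k" by auto
        then have N: "a \<in> N" "b \<in> N" "c \<in> N" unfolding C_def by auto
        have sep: "(g {u}, g {u, v}) \<notin> parcs (H k)" if "(u, v) \<in> ?T" for u v
          using that unfolding eq[symmetric] C_def by auto
        have ne: "(g {a}, g {a, b}) \<notin> parcs (H k)" "(g {b}, g {a, b}) \<notin> parcs (H k)"
          "(g {b}, g {b, c}) \<notin> parcs (H k)" "(g {c}, g {b, c}) \<notin> parcs (H k)"
          "(g {a}, g {a, c}) \<notin> parcs (H k)" "(g {c}, g {a, c}) \<notin> parcs (H k)"
          using sep[of a b] sep[of b a] sep[of b c] sep[of c b] sep[of a c] sep[of c a]
          by (simp_all add: insert_commute)
        note gN = g1[OF N(1)] g1[OF N(2)] g1[OF N(3)] g[OF N(1,2)] g[OF N(2,3)] g[OF N(1,3)]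
        have sub: "{g {a}, g {b}, g {c}, g {b, c}, g {a, c}, g {a, b}} \<subseteq> pverts (H k)"
          using gN Hk(2) by auto
        have dist: "g {a} \<noteq> g {a, c}" "g {a} \<noteq> g {a, b}" "g {b} \<noteq> g {b, c}" "g {b} \<noteq> g {a, b}"
          "g {c} \<noteq> g {b, c}" "g {c} \<noteq> g {a, c}"
          using gN abc by (metis doubleton_eq_iff insert_absorb2)+
        show False
          by (rule interval_graph_no_net[OF Hk(1) sub _ _ _ _ _ _ dist ne(5) ne(1) ne(3) ne(2) ne(4) ne(6)];
              rule edge; use gN abc in auto)
      qed
      then have "C k \<subset> ?T" using sub by (intro psubsetI)
      then have "card (C k) < card ?T" by (intro psubset_card_mono) auto
      also have "card ?T \<le> 6"
        using card_length[of "[(a, b), (b, a), (b, c), (c, b), (a, c), (c, a)]"] by simp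
      finally have "card (C k) \<le> 5" by simp
      moreover have "finite (C k)" using sub by (rule finite_subset) simp
      ultimately show ?thesis by blast
    next
      case True
      then obtain a where a: "\<And>u v. (u, v) \<in> C k \<Longrightarrow> a = u \<or> a = v" by blast
      have "\<forall>(u, v)\<in>C k. a = u \<or> a = v" using a by auto
      then show ?thesis by (intro disjI1 exI)
    qed
  qed
qed

end

section \<open>Minimal primes of a finite reduced ring\<close>

text \<open>An ideal maximal among those containing no power of \<open>x\<close> is prime.
  Finiteness provides such an ideal and a minimal prime inside it.\<close>

lemma (in cring) exists_minimal_primeideal_avoiding:
  assumes fin: "finite (carrier R)" and x: "x \<in> carrier R"
    and nonnil: "\<And>k::nat. x [^] k \<noteq> \<zero>"
  shows "\<exists>P. minimal_primeideal P R \<and> x \<notin> P"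
proof -
  \<comment> \<open>The exponent 0 is included, so every member of \<open>F\<close> omits the
    identity and is proper.\<close>
  define F where "F = {I. ideal I R \<and> (\<forall>k::nat. x [^] k \<notin> I)}"
  have fF: "finite {I. ideal I R}"
    by (rule finite_subset[of _ "Pow (carrier R)"])
      (use fin in \<open>auto dest: additive_subgroup.a_subset ideal.axioms(1)\<close>)
  then have "finite F" unfolding F_def by simp
  moreover have "{\<zero>} \<in> F" unfolding F_def using zeroideal nonnil by auto
  ultimately obtain P where P: "P \<in> F" and Pmax: "\<And>I. \<lbrakk>I \<in> F; P \<subseteq> I\<rbrakk> \<Longrightarrow> P = I"
    using finite_has_maximal[of F] by blast
  then interpret P: ideal P R unfolding F_def by simp
  \<comment> \<open>Adjoining \<open>a\<close> to \<open>P\<close> gives a strictly larger ideal,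
    which by maximality contains a power of \<open>x\<close>.\<close>
  have step: "\<exists>k::nat. \<exists>p\<in>P. \<exists>r\<in>carrier R. x [^] k = p \<oplus> r \<otimes> a"
    if a: "a \<in> carrier R" "a \<notin> P" for a
  proof -
    let ?I = "P <+>\<^bsub>R\<^esub> (PIdl a)"
    have I: "ideal ?I R" using add_ideals[OF P.ideal_axioms cgenideal_ideal[OF a(1)]] .
    have "P \<subseteq> ?I"
    proof
      fix p assume "p \<in> P"
      moreover have "\<zero> \<in> PIdl a"
        using cgenideal_ideal[OF a(1)] by (meson additive_subgroup.zero_closed ideal.axioms(1))
      ultimately show "p \<in> ?I"
        unfolding set_add_def' using P.Icarr by force
    qed
    moreover have "\<zero> \<oplus> a \<in> ?I"
      using P.zero_closed cgenideal_self[OF a(1)] unfolding set_add_def' by blast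
    then have "a \<in> ?I" using a(1) by simp
    ultimately have "?I \<notin> F" using Pmax a(2) by blast
    then obtain k :: nat where "x [^] k \<in> ?I" using I unfolding F_def by blast
    then show ?thesis unfolding set_add_def' cgenideal_def by blast
  qed
  have "primeideal P R"
  proof (rule primeidealI)
    show "ideal P R" by (rule P.ideal_axioms)
    show "cring R" by (rule is_cring)
    have "x [^] (0::nat) \<notin> P" using P unfolding F_def by blast
    then have "\<one> \<notin> P" by simp
    then show "carrier R \<noteq> P" by auto
    fix a b assume ab: "a \<in> carrier R" "b \<in> carrier R" "a \<otimes> b \<in> P"
    show "a \<in> P \<or> b \<in> P"
    proof (rule ccontr)
      assume "\<not> ?thesis"
      then obtain k m :: nat and p q r t where
        k: "p \<in> P" "r \<in> carrier R" "x [^] k = p \<oplus> r \<otimes> a" and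
        m: "q \<in> P" "t \<in> carrier R" "x [^] m = q \<oplus> t \<otimes> b"
        using step[OF ab(1)] step[OF ab(2)] by blast
      have pq: "p \<in> carrier R" "q \<in> carrier R" using k m P.Icarr by auto
      have "x [^] (k + m) = (p \<oplus> r \<otimes> a) \<otimes> (q \<oplus> t \<otimes> b)"
        using nat_pow_mult[OF x, of k m] k m by simp
      \<comment> \<open>Every summand has a factor in \<open>P\<close>, namely \<open>p\<close>,
        \<open>q\<close> or \<open>a \<otimes> b\<close>.\<close>
      also have "\<dots> = p \<otimes> (q \<oplus> t \<otimes> b) \<oplus> ((r \<otimes> a) \<otimes> q \<oplus> (r \<otimes> t) \<otimes> (a \<otimes> b))"
        using pq k(2) m(2) ab by (simp add: l_distr r_distr m_ac a_ac)
      also have "\<dots> \<in> P"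
        using k m pq ab by (intro P.a_closed P.I_l_closed[OF m(1)] P.I_l_closed[OF ab(3)] P.I_r_closed[OF k(1)]) auto
      finally show False using P unfolding F_def by blast
    qed
  qed
  define E where "E = {Q. primeideal Q R \<and> Q \<subseteq> P}"
  have "finite E"
    unfolding E_def by (rule finite_subset[OF _ fF]) (auto dest: primeideal.axioms)
  moreover have "P \<in> E" unfolding E_def using \<open>primeideal P R\<close> by simp
  ultimately obtain Q where "Q \<in> E" and min: "\<forall>Q'\<in>E. Q' \<subseteq> Q \<longrightarrow> Q = Q'"
    using finite_has_minimal[of E] by auto
  then have Q: "primeideal Q R" "Q \<subseteq> P" unfolding E_def by auto
  have "x [^] (1::nat) \<notin> P" using P unfolding F_def by blast
  then have "x \<notin> P" using x by simp
  then have "x \<notin> Q" using Q(2) by auto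
  moreover have "minimal_primeideal Q R"
    unfolding minimal_primeideal_def
  proof (intro conjI allI impI)
    show "primeideal Q R" by (rule Q(1))
    show "Q' = Q" if "primeideal Q' R \<and> Q' \<subseteq> Q" for Q'
      using min[rule_format, of Q'] that Q(2) unfolding E_def by auto
  qed
  ultimately show ?thesis by blast
qed

text \<open>Take an element of each \<open>M i\<close> outside \<open>P\<close> and multiply: the
  product lies in every \<open>M i\<close>, and primality keeps it outside \<open>P\<close>.\<close>

lemma (in cring) exists_avoiding_single_prime:
  assumes "finite I" and P: "primeideal P R"
    and M: "\<And>i. i \<in> I \<Longrightarrow> ideal (M i) R \<and> \<not> M i \<subseteq> P"
  shows "\<exists>x\<in>carrier R. x \<notin> P \<and> (\<forall>i\<in>I. x \<in> M i)"
  using assms(1) M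
proof (induction I rule: finite_induct)
  case empty
  interpret primeideal P R by (fact P)
  have "P \<subseteq> carrier R" using Icarr by auto
  then show ?case using I_notcarr by blast
next
  case (insert j I)
  interpret P: primeideal P R by (fact P)
  obtain x where x: "x \<in> carrier R" "x \<notin> P" "\<forall>i\<in>I. x \<in> M i" using insert by auto
  obtain y where y: "y \<in> M j" "y \<notin> P" using insert.prems[of j] by auto
  have yc: "y \<in> carrier R" using insert.prems[of j] y ideal.Icarr by fastforce
  have "x \<otimes> y \<notin> P" using P.I_prime x y yc by blast
  moreover have "x \<otimes> y \<in> M i" if "i \<in> insert j I" for i
    using that insert.prems[of i] x y yc ideal.I_l_closed ideal.I_r_closed by fastforce
  ultimately show ?case using x yc by blast
qed

text \<open>Sum over \<open>A\<close> elements that each avoid exactly one of the primes: modulo any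
  \<open>M i\<close> at most one summand survives.\<close>

lemma (in cring) exists_with_support:
  assumes N: "finite N" and prime: "\<And>i. i \<in> N \<Longrightarrow> primeideal (M i) R"
    and incomparable: "\<And>i j. \<lbrakk>i \<in> N; j \<in> N; i \<noteq> j\<rbrakk> \<Longrightarrow> \<not> M i \<subseteq> M j"
    and A: "A \<subseteq> N"
  shows "\<exists>x\<in>carrier R. \<forall>i\<in>N. x \<in> M i \<longleftrightarrow> i \<notin> A"
proof -
  have "finite A" using A N finite_subset by blast
  then show ?thesis using A
  proof (induction A rule: finite_induct)
    case empty
    have "\<zero> \<in> M i" if "i \<in> N" for i
      using prime[OF that] by (meson additive_subgroup.zero_closed ideal.axioms(1) primeideal.axioms(1))
    then show ?case by (intro bexI[of _ \<zero>]) auto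
  next
    case (insert j A)
    then obtain x where x: "x \<in> carrier R" "\<forall>i\<in>N. x \<in> M i \<longleftrightarrow> i \<notin> A" by auto
    have "\<exists>y\<in>carrier R. y \<notin> M j \<and> (\<forall>i\<in>N - {j}. y \<in> M i)"
      using insert.prems prime incomparable N
      by (intro exists_avoiding_single_prime) (auto dest: primeideal.axioms)
    then obtain y where y: "y \<in> carrier R" "y \<notin> M j" "\<forall>i\<in>N - {j}. y \<in> M i" by blast
    have "x \<oplus> y \<in> M i \<longleftrightarrow> i \<notin> insert j A" if i: "i \<in> N" for i
    proof -
      interpret ideal "M i" R using prime[OF i] by (rule primeideal.axioms)
      have xy: "x = x \<oplus> y \<ominus> y" "y = x \<oplus> y \<ominus> x"
        using x(1) y(1) by algebra+
      have cancel: "x \<oplus> y \<in> M i \<longleftrightarrow> x \<in> M i" if "y \<in> M i"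
        using xy(1) that a_closed by (metis a_inv_closed minus_eq)
      show ?thesis
      proof (cases "i = j")
        case True
        then have "x \<in> M i" using x(2) i insert.hyps by blast
        then have "x \<oplus> y \<notin> M i"
          using xy(2) y(2) True by (metis a_closed a_inv_closed minus_eq)
        then show ?thesis using True by simp
      next
        case False
        then show ?thesis using cancel x(2) y(3) i by auto
      qed
    qed
    then show ?case using x(1) y(1) by blast
  qed
qed

text \<open>Reducedness makes zero the only element of empty support, primality turns products into
  intersections of supports, and incomparability of the minimal primes realises every
  support.\<close>

lemma disjointness_graph_zero_divisor_graph:
  fixes R :: "('a, 'b) ring_scheme" (structure) and n :: nat
  defines "G \<equiv> zero_divisor_graph R"
  assumes R: "cring R" and fin: "finite (carrier R)" and "\<one> \<noteq> \<zero>" and "reduced_ring R"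
    and M: "bij_betw M {1..n} {P. minimal_primeideal P R}"
  defines "s \<equiv> \<lambda>x. {i \<in> {1..n}. x \<notin> M i}"
  shows "disjointness_graph G s {1..n}"
    and "pverts G = {x \<in> carrier R. s x \<noteq> {} \<and> s x \<noteq> {1..n}}"
proof -
  interpret cring R by fact
  have min: "minimal_primeideal (M i) R" if "i \<in> {1..n}" for i
    using M that by (auto simp: bij_betw_def)
  then have prime: "primeideal (M i) R" if "i \<in> {1..n}" for i
    using that unfolding minimal_primeideal_def by blast
  then have ideal: "ideal (M i) R" if "i \<in> {1..n}" for i
    using that primeideal.axioms(1) by blast
  have incomparable: "\<not> M i \<subseteq> M j" if "i \<in> {1..n}" "j \<in> {1..n}" "i \<noteq> j" for i j
  proof
    assume "M i \<subseteq> M j"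
    then have "M i = M j" using min[OF that(2)] prime[OF that(1)] unfolding minimal_primeideal_def by blast
    then show False using M that by (auto simp: bij_betw_def dest: inj_onD)
  qed
  have zero: "x = \<zero> \<longleftrightarrow> s x = {}" if x: "x \<in> carrier R" for x
  proof
    assume "x = \<zero>"
    then show "s x = {}" unfolding s_def
      using ideal by (auto intro: additive_subgroup.zero_closed ideal.axioms(1))
  next
    assume sx: "s x = {}"
    show "x = \<zero>"
    proof (rule ccontr)
      assume "x \<noteq> \<zero>"
      \<comment> \<open>Positive exponents use reducedness; the exponent 0 uses that the identity is
        non-zero.\<close>
      have "x [^] k \<noteq> \<zero>" for k :: nat
        using \<open>x \<noteq> \<zero>\<close> x \<open>\<one> \<noteq> \<zero>\<close> \<open>reduced_ring R\<close> unfolding reduced_ring_def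
        by (cases "k = 0") auto
      then obtain P where "minimal_primeideal P R" "x \<notin> P"
        using exists_minimal_primeideal_avoiding[OF fin x] by blast
      moreover then have "P \<in> M ` {1..n}" using M by (simp add: bij_betw_def)
      ultimately obtain i where "i \<in> {1..n}" "x \<notin> M i" by blast
      then show False using sx unfolding s_def by blast
    qed
  qed
  have mult: "s (x \<otimes> y) = s x \<inter> s y" if xy: "x \<in> carrier R" "y \<in> carrier R" for x y
  proof -
    have "x \<otimes> y \<in> M i \<longleftrightarrow> x \<in> M i \<or> y \<in> M i" if i: "i \<in> {1..n}" for i
    proof -
      interpret primeideal "M i" R using prime[OF i] .
      show ?thesis using I_prime[OF xy] I_l_closed[of y x] I_r_closed[of x y] xy by blast
    qed
    then show ?thesis unfolding s_def by auto
  qed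
  have ex: "\<exists>x\<in>carrier R. s x = A" if A: "A \<subseteq> {1..n}" for A
  proof -
    obtain x where "x \<in> carrier R" "\<forall>i\<in>{1..n}. x \<in> M i \<longleftrightarrow> i \<notin> A"
      using exists_with_support[of "{1..n}" M A] prime incomparable A by blast
    then show ?thesis using A unfolding s_def by (intro bexI[of _ x]) auto
  qed
  have sub: "s x \<subseteq> {1..n}" for x unfolding s_def by auto
  have verts: "x \<in> zero_divisors R - {\<zero>} \<longleftrightarrow> x \<in> carrier R \<and> s x \<noteq> {} \<and> s x \<noteq> {1..n}" for x
  proof (cases "x \<in> carrier R")
    case x: True
    \<comment> \<open>If the support of \<open>x\<close> is proper, an element of complementary
      support is a non-zero annihilator.\<close>
    have "(\<exists>y\<in>carrier R - {\<zero>}. x \<otimes> y = \<zero>) \<longleftrightarrow> s x \<noteq> {1..n}"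
    proof
      assume "\<exists>y\<in>carrier R - {\<zero>}. x \<otimes> y = \<zero>"
      then obtain y where y: "y \<in> carrier R" "y \<noteq> \<zero>" "x \<otimes> y = \<zero>" by auto
      then have "s x \<inter> s y = {}" "s y \<noteq> {}"
        using mult[OF x y(1)] zero x by auto
      then show "s x \<noteq> {1..n}" using sub[of y] by blast
    next
      assume ne: "s x \<noteq> {1..n}"
      obtain y where y: "y \<in> carrier R" "s y = {1..n} - s x" using ex[of "{1..n} - s x"] by auto
      then have "y \<noteq> \<zero>" using ne sub[of x] zero[OF y(1)] by auto
      moreover have "x \<otimes> y = \<zero>" using mult[OF x y(1)] y zero x by auto
      ultimately show "\<exists>y\<in>carrier R - {\<zero>}. x \<otimes> y = \<zero>" using y by auto
    qed
    then show ?thesis using x zero[OF x] unfolding zero_divisors_def by auto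
  qed (simp add: zero_divisors_def)
  show "pverts G = {x \<in> carrier R. s x \<noteq> {} \<and> s x \<noteq> {1..n}}"
    unfolding G_def zero_divisor_graph_def pair_pre_digraph.simps using verts by blast
  show "disjointness_graph G s {1..n}"
    unfolding G_def
  proof
    show "finite (pverts (zero_divisor_graph R))"
      using fin unfolding zero_divisor_graph_def zero_divisors_def by simp
    have "A \<in> s ` (zero_divisors R - {\<zero>})" if "A \<subseteq> {1..n}" "A \<noteq> {}" "A \<noteq> {1..n}" for A
      using ex[OF that(1)] that verts by blast
    moreover have "s x \<subseteq> {1..n} \<and> s x \<noteq> {} \<and> s x \<noteq> {1..n}" if "x \<in> zero_divisors R - {\<zero>}" for x
      using that verts sub by blast
    ultimately show "s ` pverts (zero_divisor_graph R) = {A. A \<subseteq> {1..n} \<and> A \<noteq> {} \<and> A \<noteq> {1..n}}"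
      unfolding zero_divisor_graph_def pair_pre_digraph.simps by blast
    fix u v
    have "u \<otimes> v = \<zero> \<longleftrightarrow> s u \<inter> s v = {}" if "u \<in> carrier R" "v \<in> carrier R"
      using zero[of "u \<otimes> v"] mult that by auto
    then show "(u, v) \<in> parcs (zero_divisor_graph R) \<longleftrightarrow>
      u \<in> pverts (zero_divisor_graph R) \<and> v \<in> pverts (zero_divisor_graph R) \<and> u \<noteq> v \<and> s u \<inter> s v = {}"
      unfolding zero_divisor_graph_def zero_divisors_def by auto
  qed simp
qed

section \<open>The values of both dimensions by the number of minimal primes\<close>

theorem theorem8:
  fixes R :: "('a, 'b) ring_scheme" (structure)
    and n :: nat
    and M :: "nat \<Rightarrow> 'a set"
  assumes "cring R"
    and "finite (carrier R)"
    and "\<one> \<noteq> \<zero>"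
    and "reduced_ring R"
    and "bij_betw M {1..n} {P. minimal_primeideal P R}"
  shows "(n = 1 \<longrightarrow>
            boxicity (zero_divisor_graph R) = 0 \<and>
            threshold_dimension (zero_divisor_graph R) = 0) \<and>
         (n = 2 \<longrightarrow>
            boxicity (zero_divisor_graph R) = threshold_dimension (zero_divisor_graph R) \<and>
            threshold_dimension (zero_divisor_graph R) =
              (if lonely R n M 1 \<and> lonely R n M 2 then 0
               else if lonely R n M 1 \<noteq> lonely R n M 2 then 1
               else 2)) \<and>
         (n \<ge> 3 \<longrightarrow>
            boxicity (zero_divisor_graph R) = threshold_dimension (zero_divisor_graph R) \<and>
            threshold_dimension (zero_divisor_graph R) =
              (if \<exists>i\<in>{1..n}. lonely R n M i then n - 1 else n))"
proof -
  define G where "G = zero_divisor_graph R"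
  define s where "s x = {i \<in> {1..n}. x \<notin> M i}" for x
  interpret disjointness_graph G s "{1..n}"
    unfolding G_def s_def by (rule disjointness_graph_zero_divisor_graph(1)[OF assms])
  have verts: "pverts G = {x \<in> carrier R. s x \<noteq> {} \<and> s x \<noteq> {1..n}}"
    unfolding G_def s_def by (rule disjointness_graph_zero_divisor_graph(2)[OF assms])
  have dims: "boxicity G = k \<and> threshold_dimension G = k"
    if "is_intersection_of G k threshold_graph"
      "\<And>d. is_intersection_of G d interval_graph \<Longrightarrow> k \<le> d" for k
    using boxicity_eq_threshold_dimension_eq that by blast
  have complete: "boxicity G = 0 \<and> threshold_dimension G = 0"
    if "\<And>u v. \<lbrakk>u \<in> pverts G; v \<in> pverts G; u \<noteq> v\<rbrakk> \<Longrightarrow> s u \<inter> s v = {}"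
  proof (rule dims)
    show "is_intersection_of G 0 threshold_graph"
      unfolding is_intersection_of_def using that arc_iff by auto
  qed simp
  have singleton_ne: "{j} \<noteq> {1..n}" if "n \<ge> 2" for j
  proof
    assume "{j} = {1..n}"
    then have "card {1..n} = card {j}" by simp
    then show False using that by simp
  qed
  \<comment> \<open>For at least two primes \<open>{j}\<close> is a proper support, so the elements
    counted by loneliness are vertices.\<close>
  have lonely_iff: "lonely R n M j \<longleftrightarrow> card {v \<in> pverts G. s v = {j}} = 1"
    if n: "n \<ge> 2" and j: "j \<in> {1..n}" for j
  proof -
    have "s v = {j} \<longleftrightarrow> (\<forall>i\<in>{1..n} - {j}. v \<in> M i) \<and> v \<notin> M j" for v
      using j unfolding s_def by blast
    then have "carrier R \<inter> (\<Inter>i\<in>{1..n} - {j}. M i) - M j = {v \<in> carrier R. s v = {j}}"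
      by blast
    also have "\<dots> = {v \<in> pverts G. s v = {j}}"
      using singleton_ne[OF n, of j] unfolding verts by fastforce
    finally have "carrier R \<inter> (\<Inter>i\<in>{1..n} - {j}. M i) - M j = {v \<in> pverts G. s v = {j}}" .
    then show ?thesis unfolding lonely_def by simp
  qed
  have lonely: "u = v"
    if "n \<ge> 2" "j \<in> {1..n}" "lonely R n M j" "u \<in> pverts G" "v \<in> pverts G" "s u = {j}" "s v = {j}"
    for j u v
  proof -
    have "card {v \<in> pverts G. s v = {j}} = 1" using lonely_iff that by blast
    then obtain w where w: "{v \<in> pverts G. s v = {j}} = {w}" by (rule card_1_singletonE)
    have "u \<in> {w}" "v \<in> {w}" unfolding w[symmetric] using that by simp_all
    then show ?thesis by simp
  qed
  have not_lonely: "\<exists>u\<in>pverts G. \<exists>v\<in>pverts G. u \<noteq> v \<and> s u = {j} \<and> s v = {j}"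
    if "n \<ge> 2" "j \<in> {1..n}" "\<not> lonely R n M j" for j
  proof -
    have "{j} \<in> s ` pverts G"
      using singleton_ne[OF that(1), of j] that(2) unfolding supports by blast
    then obtain u where u: "u \<in> pverts G" "s u = {j}" by auto
    have "{v \<in> pverts G. s v = {j}} \<noteq> {u}"
      using lonely_iff[OF that(1,2)] that(3) by auto
    then show ?thesis using u by blast
  qed
  have upper: "is_intersection_of G (n - 1) threshold_graph"
    if "n \<ge> 2" "j \<in> {1..n}" "lonely R n M j" for j
    using is_intersection_threshold_unique[OF that(2)] lonely[OF that] by simp
  have none_lonely: "boxicity G = n \<and> threshold_dimension G = n"
    if "n \<ge> 2" "\<And>j. j \<in> {1..n} \<Longrightarrow> \<not> lonely R n M j"
  proof (rule dims)
    show "is_intersection_of G n threshold_graph" using is_intersection_threshold by simp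
    show "n \<le> d" if "is_intersection_of G d interval_graph" for d
      using card_nonunique_le[OF that, of "{1..n}"] not_lonely \<open>n \<ge> 2\<close>
        \<open>\<And>j. j \<in> {1..n} \<Longrightarrow> \<not> lonely R n M j\<close> by simp
  qed
  have some_lonely: "boxicity G = n - 1 \<and> threshold_dimension G = n - 1"
    if "n \<ge> 3" "j \<in> {1..n}" "lonely R n M j" for j
    using that upper[of j] card_minus_1_le by (intro dims) auto
  \<comment> \<open>For two primes the lower bound comes from the single non-lonely prime, since the
    bound by stars and triangles starts at three.\<close>
  have one_lonely: "boxicity G = 1 \<and> threshold_dimension G = 1"
    if "n = 2" "j \<in> {1..n}" "lonely R n M j" "k \<in> {1..n}" "\<not> lonely R n M k" for j k
  proof (rule dims)
    show "is_intersection_of G 1 threshold_graph" using upper[of j] that by simp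
    show "1 \<le> d" if "is_intersection_of G d interval_graph" for d
      using card_nonunique_le[OF that, of "{k}"] not_lonely[of k] \<open>n = 2\<close> \<open>k \<in> {1..n}\<close>
        \<open>\<not> lonely R n M k\<close> by simp
  qed
  \<comment> \<open>At most one vertex has each of the supports \<open>{1}\<close> and
    \<open>{2}\<close>, so distinct vertices are adjacent.\<close>
  have both_lonely: "boxicity G = 0 \<and> threshold_dimension G = 0"
    if "n = 2" "lonely R n M 1" "lonely R n M 2"
  proof (rule complete)
    fix u v assume uv: "u \<in> pverts G" "v \<in> pverts G" "u \<noteq> v"
    have two: "{1..n} = {1, 2}" using \<open>n = 2\<close> by auto
    have "s x = {1} \<or> s x = {2}" if "x \<in> pverts G" for x
      using support_props[OF that] unfolding two by blast
    then have "s u = {1} \<or> s u = {2}" "s v = {1} \<or> s v = {2}" using uv by auto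
    then show "s u \<inter> s v = {}"
      using lonely[of 1 u v] lonely[of 2 u v] uv that by auto
  qed
  \<comment> \<open>A one-element set has no non-empty proper subset, so the graph has no
    vertices.\<close>
  have no_verts: "boxicity G = 0 \<and> threshold_dimension G = 0" if "n = 1"
    using support_props that by (intro complete) force
  show ?thesis
    unfolding G_def[symmetric]
  proof (intro conjI impI)
    assume n: "n = 2"
    then have two: "j = 1 \<or> j = 2" if "j \<in> {1..n}" for j using that by auto
    have mem: "1 \<in> {1..n}" "2 \<in> {1..n}" using n by auto
    have "boxicity G = threshold_dimension G \<and> threshold_dimension G =
        (if lonely R n M 1 \<and> lonely R n M 2 then 0
         else if lonely R n M 1 \<noteq> lonely R n M 2 then 1 else 2)"
    proof (cases "lonely R n M 1"; cases "lonely R n M 2")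
      assume "lonely R n M 1" "lonely R n M 2"
      then show ?thesis using both_lonely n by simp
    next
      assume "lonely R n M 1" "\<not> lonely R n M 2"
      then show ?thesis using one_lonely[OF n mem(1) _ mem(2)] by simp
    next
      assume "\<not> lonely R n M 1" "lonely R n M 2"
      then show ?thesis using one_lonely[OF n mem(2) _ mem(1)] by simp
    next
      assume *: "\<not> lonely R n M 1" "\<not> lonely R n M 2"
      then have "\<not> lonely R n M j" if "j \<in> {1..n}" for j using two[OF that] by auto
      then show ?thesis using none_lonely n * by simp
    qed
    then show "boxicity G = threshold_dimension G"
      "threshold_dimension G =
        (if lonely R n M 1 \<and> lonely R n M 2 then 0
         else if lonely R n M 1 \<noteq> lonely R n M 2 then 1 else 2)"
      by blast+
  next
    assume n: "n \<ge> 3"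
    have "boxicity G = threshold_dimension G \<and> threshold_dimension G =
        (if \<exists>i\<in>{1..n}. lonely R n M i then n - 1 else n)"
    proof (cases "\<exists>i\<in>{1..n}. lonely R n M i")
      case True
      then show ?thesis using some_lonely[OF n] by auto
    next
      case False
      then show ?thesis using none_lonely n by auto
    qed
    then show "boxicity G = threshold_dimension G"
      "threshold_dimension G = (if \<exists>i\<in>{1..n}. lonely R n M i then n - 1 else n)"
      by blast+
  qed (use no_verts in simp_all)
qed

end
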